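(* Let $n$ be the smallest positive integer such that $\gcd(n,6)=1$ and there exists a minimal zero-sum sequence of length $4$ over $\mathbb{Z}/n$ whose index is not $1$. Let $S=(x_1)(x_2)(x_3)(x_4)$ be a minimal zero-sum sequence over $\mathbb{Z}/n$ with $\mathrm{ind}(S)=2$, where the $x_i$ are viewed as integers with $1\le x_i\le n$. Then $\gcd(n,x_i)=1$ for all $i\in\{1,2,3,4\}$. Moreover, let $n$ be any positive integer such that $\gcd(n,6)=1$ and there exists a minimal zero-sum sequence of length $4$ over $\mathbb{Z}/n$ whose index is not $1$, and let $S=(x_1)(x_2)(x_3)(x_4)$ be a minimal zero-sum sequence over $\mathbb{Z}/n$ with $\mathrm{ind}(S)=2$. If $\gcd(n,x_i)=1$ for all $i$, then $$t(\overline{x_{\sigma(1)}}\,x_{\sigma(2)},n)=t(\overline{x_{\sigma(3)}}\,x_{\sigma(4)},n)$$ for every permutation $\sigma$ of $\{1,2,3,4\}$, where $\overline{x}$ denotes the inverse of $x$ in the multiplicative group $(\mathbb{Z}/n)^*$.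
   Context: Let $G$ be a finite cyclic group of order $n$, written additively. A sequence of length $k$ over $G$ is a (multi)set of $k$ elements $a_1,\dots,a_k$ of $G$, written $(a_1)\cdots(a_k)$. It is a zero-sum sequence if $\sum_i a_i=0$, and a minimal zero-sum sequence if it is zero-sum but no proper nonempty subsequence is zero-sum. For a generator $g$ of $G$, write $S=(y_1g)\cdots(y_kg)$ with integers $1\le y_i\le n$, and define the $g$-norm $\|S\|_g=\frac{1}{n}\sum_{i=1}^k y_i$. The index of $S$ is $\mathrm{ind}(S)=\min_g\|S\|_g$, the minimum over all generators $g$ of $G$. For integers $k\ge1$ and $h$ with $\gcd(h,k)=1$, define $$t(h,k)=\sum_{\substack{1\le r\le k\\ \gcd(r,k)=1}}\frac{r}{k}\Big(\frac{hr}{k}-\Big\lfloor\frac{hr}{k}\Big\rfloor-\frac12\Big).$$ *)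

theory Defs
  imports Complex_Main "HOL-Library.Multiset" "HOL-Number_Theory.Number_Theory"
    "HOL-Combinatorics.Permutations"
begin

text \<open>
  An element of \<open>\<int>/n\<close> (\<open>n \<ge> 1\<close>) is represented by its representative in \<open>{1..n}\<close>, so that zero is
  represented by \<open>n\<close>. Equality in \<open>\<int>/n\<close> is congruence modulo \<open>n\<close>, and a sequence is a multiset of
  representatives.
\<close>

definition zero_sum :: "nat \<Rightarrow> int multiset \<Rightarrow> bool" where
  "zero_sum n S \<longleftrightarrow> set_mset S \<subseteq> {1..int n} \<and> [\<Sum>\<^sub># S = 0] (mod int n)"

text \<open>
  The empty sequence is excluded; otherwise it would satisfy the condition on subsequences vacuously.
\<close>

definition minimal_zero_sum :: "nat \<Rightarrow> int multiset \<Rightarrow> bool" where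
  "minimal_zero_sum n S \<longleftrightarrow>
     S \<noteq> {#} \<and> zero_sum n S \<and> (\<forall>T. T \<subset># S \<and> T \<noteq> {#} \<longrightarrow> \<not> zero_sum n T)"

definition generators :: "nat \<Rightarrow> int set" where
  "generators n = {g \<in> {1..int n}. \<forall>a. \<exists>m::int. [m * g = a] (mod int n)}"

definition coefficient :: "nat \<Rightarrow> int \<Rightarrow> int \<Rightarrow> int" where
  "coefficient n g a = (THE y. y \<in> {1..int n} \<and> [y * g = a] (mod int n))"

definition seq_norm :: "nat \<Rightarrow> int \<Rightarrow> int multiset \<Rightarrow> real" where
  "seq_norm n g S = of_int (\<Sum>a\<in>#S. coefficient n g a) / of_nat n"

definition seq_index :: "nat \<Rightarrow> int multiset \<Rightarrow> real" where
  "seq_index n S = Min ((\<lambda>g. seq_norm n g S) ` generators n)"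

definition exceptional :: "nat \<Rightarrow> bool" where
  "exceptional n \<longleftrightarrow> n > 0 \<and> coprime n 6 \<and>
     (\<exists>S. minimal_zero_sum n S \<and> size S = 4 \<and> seq_index n S \<noteq> 1)"

definition t :: "int \<Rightarrow> nat \<Rightarrow> real" where
  "t h k = (\<Sum>r | r \<in> {1..k} \<and> coprime r k.
     real r / real k *
       (of_int h * real r / real k - of_int \<lfloor>of_int h * real r / real k\<rfloor> - 1 / 2))"

text \<open>The following shows that the definite description in \<^const>\<open>coefficient\<close> is proper.\<close>

lemma coefficient_unique:
  assumes g: "g \<in> generators n"
  shows "\<exists>!y. y \<in> {1..int n} \<and> [y * g = a] (mod int n)"
proof (rule ex_ex1I)
  from g have n: "int n > 0" by (auto simp: generators_def)
  from g obtain m where m: "[m * g = a] (mod int n)" by (auto simp: generators_def)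
  define y where "y = (m - 1) mod int n + 1"
  have "y \<in> {1..int n}" using n by (simp add: y_def add1_zle_eq)
  moreover have "[y = m] (mod int n)"
    by (simp add: y_def cong_def mod_add_left_eq)
  then have "[y * g = a] (mod int n)" using m cong_scalar_right cong_trans by blast
  ultimately show "\<exists>y. y \<in> {1..int n} \<and> [y * g = a] (mod int n)" by blast
next
  fix y z
  assume y: "y \<in> {1..int n} \<and> [y * g = a] (mod int n)"
    and z: "z \<in> {1..int n} \<and> [z * g = a] (mod int n)"
  from g obtain m where m: "[m * g = 1] (mod int n)" by (auto simp: generators_def)
  then have "coprime g (int n)"
    by (metis cong_imp_coprime cong_sym coprime_1_left coprime_mult_left_iff)
  moreover have "[y * g = z * g] (mod int n)" using y z cong_trans cong_sym by blast
  ultimately have "[y = z] (mod int n)" by (simp add: cong_mult_rcancel)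
  then have "int n dvd y - z" by (simp add: cong_iff_dvd_diff)
  moreover have "\<bar>y - z\<bar> < int n" using y z by auto
  ultimately show "y = z" using dvd_imp_le_int[of "y - z" "int n"] by force
qed

text \<open>
  The value of \<^const>\<open>t\<close> depends only on the residue class of its first argument, so any
  representative of an inverse modulo \<open>k\<close> may be used in it.
\<close>

lemma t_cong:
  assumes "[h = h'] (mod int k)"
  shows "t h k = t h' k"
proof -
  from assms obtain m where m: "h = h' + m * int k"
    by (metis cong_iff_lin cong_sym mult.commute)
  have frac: "of_int h * real r / real k - of_int \<lfloor>of_int h * real r / real k\<rfloor>
      = of_int h' * real r / real k - of_int \<lfloor>of_int h' * real r / real k\<rfloor>" for r
  proof (cases "k = 0")
    case False
    have "of_int h * real r / real k = of_int h' * real r / real k + of_int (m * int r)"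
      using False by (simp add: m field_simps)
    then show ?thesis by (simp only: floor_add_int[symmetric] of_int_add)
  qed simp
  show ?thesis unfolding t_def frac ..
qed

end

theory Submission
  imports Defs
begin

text \<open>
  Index \<open>2\<close> means that for every unit \<open>u\<close> the least residues of the \<open>u x\<^sub>i\<close> modulo \<open>n\<close> add up to
  exactly \<open>2 n\<close>: they add up to at least \<open>2 n\<close>, and replacing \<open>u\<close> by \<open>- u\<close> turns a sum \<open>R\<close> into
  \<open>4 n - R\<close>.

  For the first claim, let a prime \<open>p\<close> divide \<open>n = m p\<close> and some \<open>x\<^sub>i\<close>. If \<open>p\<close> divides all four,
  then \<open>n / p\<close> is exceptional. Otherwise \<open>p\<close> divides one or two of them, and we vary \<open>u\<close> in a fixed
  class modulo \<open>m\<close>, which does not change the residues of the \<open>u x\<^sub>i\<close> with \<open>p dvd x\<^sub>i\<close>. If there are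
  two of these, the other two residues have a constant sum although each of them takes almost all
  values in its class modulo \<open>m\<close>; hence this sum lies within \<open>2 m\<close> of \<open>n\<close>, for every \<open>u\<close>, which is
  absurd. If there is only one and \<open>p\<close> divides \<open>m\<close>, summing over the class bounds the fourth residue
  below by more than \<open>n / 5\<close>, again for every \<open>u\<close>. If \<open>p\<close> does not divide \<open>m\<close>, the same sum relates the
  residue sums modulo \<open>m\<close> at \<open>w\<close> and \<open>p w\<close>; along the orbit of a suitable \<open>w\<close> under multiplication
  by \<open>p\<close> these sums, which are \<open>m\<close>, \<open>2 m\<close> or \<open>3 m\<close>, would have to vary too much.

  For the second claim, \<open>t (x\<^sup>-\<^sup>1 y) n\<close> is the correlation over the units \<open>r\<close> of the centred residues
  of \<open>x r\<close> and \<open>y r\<close>. The \<open>4 \<times> 4\<close> matrix of correlations is symmetric with constant diagonal and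
  vanishing row sums, so opposite entries agree.
\<close>

section \<open>Units modulo \<open>n\<close> and residues along a class modulo a divisor\<close>

lemma coprime_lift:
  fixes a M n :: int
  assumes "coprime a M" "n \<noteq> 0"
  shows "\<exists>u. coprime u n \<and> [u = a] (mod M)"
proof -
  \<comment> \<open>Each prime divisor of \<open>n\<close> divides exactly one of \<open>a\<close> and \<open>M q\<close>.\<close>
  define q where "q = \<Prod>{p \<in> prime_factors n. \<not> p dvd a}"
  have "coprime (a + M * q) n"
  proof (rule ccontr)
    assume "\<not> coprime (a + M * q) n"
    then obtain e where "e dvd a + M * q" "e dvd n" "\<not> is_unit e"
      using coprimeI by blast
    then obtain p where p: "prime p" "p dvd a + M * q" "p dvd n"
      using assms(2) prime_divisor_exists[of e] by (metis dvd_trans dvd_0_left_iff)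
    show False
    proof (cases "p dvd a")
      case True
      then have "p dvd M * q" using p(2) by (simp add: dvd_add_right_iff)
      moreover have "\<not> p dvd M"
        using True assms(1) p(1) by (meson coprime_common_divisor not_prime_unit)
      ultimately have "p dvd q" using p(1) prime_dvd_mult_iff by blast
      then obtain r where "r \<in> prime_factors n" "\<not> r dvd a" "p dvd r"
        unfolding q_def using p(1) by (subst (asm) prime_dvd_prod_iff) auto
      then show False using True p(1) primes_dvd_imp_eq by blast
    next
      case False
      then have "p dvd q"
        unfolding q_def using p assms(2) by (intro dvd_prodI) (auto simp: prime_factors_dvd)
      then show False using p(2) False by (simp add: dvd_add_left_iff)
    qed
  qed
  moreover have "[a + M * q = a] (mod M)" by (simp add: cong_def)
  ultimately show ?thesis by blast
qed

text \<open>With \<open>g = gcd c n\<close>, the quotient \<open>c div g\<close> is invertible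
  modulo \<open>n div g\<close>; \<open>k\<close> times its inverse is a unit there and lifts to a
  unit modulo \<open>n\<close>. This provides units that move a given element to a convenient
  residue.\<close>

lemma unit_multiple_eq_gcd_multiple:
  fixes c k n :: int
  assumes n: "n > 0" and k: "coprime k (n div gcd c n)"
  shows "\<exists>u. coprime u n \<and> [u * c = k * gcd c n] (mod n)"
proof -
  define g where "g = gcd c n"
  define M where "M = n div g"
  define c' where "c' = c div g"
  have g: "g > 0" using n by (simp add: g_def gcd_pos_int)
  have nM: "n = M * g" and cc: "c = c' * g" by (simp_all add: g_def M_def c'_def)
  have "coprime c' M" using n unfolding c'_def M_def g_def by (intro div_gcd_coprime) auto
  then obtain v where v: "[c' * v = 1] (mod M)" using cong_solve_coprime_int by blast
  then have "coprime v M"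
    by (metis cong_imp_coprime cong_sym coprime_1_left coprime_mult_left_iff)
  then have "coprime (k * v) M" using k by (simp add: M_def g_def)
  then obtain u where u: "coprime u n" "[u = k * v] (mod M)"
    using coprime_lift[of "k * v" M n] n by auto
  have "[u * c' = k * v * c'] (mod M)" using u(2) by (rule cong_scalar_right)
  also have "k * v * c' = k * (c' * v)" by simp
  also have "[k * (c' * v) = k * 1] (mod M)" using v by (rule cong_scalar_left)
  finally have "M dvd u * c' - k" by (simp add: cong_iff_dvd_diff)
  then have "M * g dvd (u * c' - k) * g" by simp
  then have "[u * c = k * g] (mod n)"
    by (simp add: cong_iff_dvd_diff nM cc algebra_simps)
  then show ?thesis using u(1) g_def by blast
qed

lemma inj_on_affine_mod:
  fixes x p :: int
  assumes "coprime x p"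
  shows "inj_on (\<lambda>l. (q + x * l) mod p) {0..<p}"
proof (rule inj_onI)
  fix l l' assume l: "l \<in> {0..<p}" "l' \<in> {0..<p}" and "(q + x * l) mod p = (q + x * l') mod p"
  then have "[q + x * l = q + x * l'] (mod p)" by (simp add: cong_def)
  then have "[l = l'] (mod p)"
    using assms by (simp add: cong_add_lcancel cong_mult_lcancel)
  then show "l = l'" using l by (simp add: cong_def)
qed

lemma affine_mod_image:
  fixes x p :: int
  assumes "coprime x p"
  shows "(\<lambda>l. (q + x * l) mod p) ` {0..<p} = {0..<p}"
  using inj_on_affine_mod[OF assms] by (intro endo_inj_surj) auto

lemma sum_int_lessThan: "2 * (\<Sum>j\<in>{0..<p::int}. j) = p * (p - 1)" if "p \<ge> 0"
  using that
proof (induction p rule: int_ge_induct)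
  case (step i)
  have "{0..<i + 1} = insert i {0..<i}" using step.hyps by auto
  then show ?case using step.IH by (simp add: algebra_simps)
qed simp

text \<open>Along the class of \<open>u\<close> modulo \<open>m\<close>, the low digit in base
  \<open>m\<close> stays fixed and only the high digit, taken modulo \<open>p\<close>, moves with
  \<open>l\<close>.\<close>

lemma mod_mult_split:
  fixes x u m l p :: int
  assumes "m > 0" "p > 0"
  shows "(x * (u + m * l)) mod (m * p) = (x * u) mod m + m * (((x * u) div m + x * l) mod p)"
proof -
  have e: "x * (u + m * l) = x * u + m * (x * l)" by (simp add: algebra_simps)
  have "(x * (u + m * l)) mod (m * p)
      = m * ((x * (u + m * l)) div m mod p) + (x * (u + m * l)) mod m"
    using assms by (simp add: zmod_zmult2_eq)
  then show ?thesis using assms by (simp add: e add.commute)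
qed

text \<open>The low digit is constant and the high digit takes each value in \<open>{0..<p}\<close>
  exactly once. Both sides are doubled to keep the triangular number integral.\<close>

lemma sum_residues_over_fibre:
  fixes x u m p :: int
  assumes "m > 0" "p > 0" "coprime x p"
  shows "2 * (\<Sum>l\<in>{0..<p}. (x * (u + m * l)) mod (m * p)) = 2 * p * ((x * u) mod m) + m * (p * (p - 1))"
proof -
  define q where "q = (x * u) div m"
  have "(\<Sum>l\<in>{0..<p}. (q + x * l) mod p) = (\<Sum>j\<in>{0..<p}. j)"
    using sum.reindex[OF inj_on_affine_mod[OF assms(3), of q], of "\<lambda>j. j"]
      affine_mod_image[OF assms(3), of q] by simp
  then have "2 * (\<Sum>l\<in>{0..<p}. (q + x * l) mod p) = p * (p - 1)"
    using sum_int_lessThan[of p] assms by simp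
  moreover have "(\<Sum>l\<in>{0..<p}. (x * (u + m * l)) mod (m * p))
      = p * ((x * u) mod m) + m * (\<Sum>l\<in>{0..<p}. (q + x * l) mod p)"
    using assms by (simp add: mod_mult_split q_def sum.distrib sum_distrib_left)
  ultimately show ?thesis by (simp add: distrib_left mult.left_commute[of 2 m])
qed

section \<open>Balanced quadruples of residues\<close>

text \<open>This is index 2 for entries that are not multiples of \<open>n\<close>, freed from
  generators and coefficients. Letting \<open>u\<close> range over all integers prime to
  \<open>n\<close> makes negation and shifts by multiples of \<open>m\<close> available without
  reduction.\<close>

definition balanced :: "int \<Rightarrow> int \<Rightarrow> int \<Rightarrow> int \<Rightarrow> int \<Rightarrow> bool" where
  "balanced n a b c d \<longleftrightarrow>
    (\<forall>u. coprime u n \<longrightarrow> (a * u) mod n + (b * u) mod n + (c * u) mod n + (d * u) mod n = 2 * n)"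

lemma dvd_sum_residues_iff:
  fixes m a b c d :: int
  shows "m dvd a mod m + b mod m + c mod m + d mod m \<longleftrightarrow> m dvd a + b + c + d"
proof -
  have "[a mod m + b mod m + c mod m + d mod m = a + b + c + d] (mod m)"
    by (intro cong_add) (simp_all add: cong_def)
  then show ?thesis by (rule cong_dvd_iff)
qed

lemma balanced_dvd_sum:
  assumes "balanced n a b c d"
  shows "n dvd a + b + c + d"
proof -
  have "a mod n + b mod n + c mod n + d mod n = 2 * n"
    using assms by (auto simp: balanced_def dest: spec[of _ 1])
  then show ?thesis by (metis dvd_sum_residues_iff dvd_triv_right)
qed

lemma coprime_6_int_iff: "coprime M 6 \<longleftrightarrow> \<not> 2 dvd M \<and> \<not> 3 dvd M" for M :: int
proof -
  have "coprime M (2 * 3) \<longleftrightarrow> \<not> 2 dvd M \<and> \<not> 3 dvd M"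
    unfolding coprime_mult_right_iff
    using prime_imp_coprime[of "2::int" M] prime_imp_coprime[of "3::int" M]
    by (auto simp: coprime_commute)
  then show ?thesis by simp
qed

lemma ge_5_if_coprime_6:
  fixes M :: int
  assumes "coprime M 6" "M > 1"
  shows "M \<ge> 5"
proof -
  have "M \<noteq> 2" "M \<noteq> 3" "M \<noteq> 4" using assms(1) by (auto simp: coprime_6_int_iff)
  then show ?thesis using assms(2) by linarith
qed

text \<open>The quotient is the order of \<open>c\<close> in the group; it is a divisor of
  \<open>n\<close> larger than 1 and prime to 6, hence at least 5. The bound
  \<open>5 * gcd c n \<le> n\<close> is what the later estimates consume.\<close>

lemma coprime_6_gcd_quotient:
  fixes n c :: int
  assumes "n > 0" "coprime n 6" "\<not> n dvd c"
  shows "n = gcd c n * (n div gcd c n)" "coprime (n div gcd c n) 6" "n div gcd c n \<ge> 5"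
    "gcd c n > 0" "5 * gcd c n \<le> n"
proof -
  define g M where "g = gcd c n" and "M = n div g"
  have g: "g > 0" using assms(1) by (simp add: g_def gcd_pos_int)
  have nM: "n = g * M" by (simp add: g_def M_def)
  have M: "coprime M 6" using assms(2) unfolding nM by simp
  have "M > 0" using nM g assms(1) by (simp add: zero_less_mult_iff)
  moreover have "M \<noteq> 1"
  proof
    assume "M = 1"
    then have "n = g" using nM by simp
    then show False using assms(3) g_def by (metis gcd_dvd1)
  qed
  ultimately have "M \<ge> 5" using ge_5_if_coprime_6[OF M] by simp
  then have "g * 5 \<le> g * M" using g by (intro mult_left_mono) auto
  then have "5 * g \<le> n" unfolding nM by simp
  show "n = gcd c n * (n div gcd c n)" "coprime (n div gcd c n) 6" "n div gcd c n \<ge> 5"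
    "gcd c n > 0" "5 * gcd c n \<le> n"
    unfolding g_def[symmetric] M_def[symmetric] by fact+
qed

text \<open>Since \<open>a\<close> is invertible modulo \<open>p\<close>, a shift of
  \<open>u\<close> by a suitable multiple of \<open>m\<close> brings \<open>a * u\<close> to any
  target in its class modulo \<open>m\<close>. A target prime to \<open>p\<close> forces the shifted
  element to be prime to \<open>p\<close> as well.\<close>

lemma unit_in_fibre:
  fixes m p u a X :: int
  assumes p: "prime p" and u: "coprime u m" and a: "\<not> p dvd a"
    and X: "[X = a * u] (mod m)" "\<not> p dvd X"
  shows "\<exists>u'. coprime u' (m * p) \<and> [u' = u] (mod m) \<and> [a * u' = X] (mod (m * p))"
proof -
  obtain s where s: "X - a * u = m * s" using X(1) by (auto simp: cong_iff_dvd_diff)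
  have "coprime a p" using p a by (metis coprime_commute prime_imp_coprime)
  then obtain l0 where l0: "[a * l0 = 1] (mod p)" using cong_solve_coprime_int by blast
  define u' where "u' = u + m * (l0 * s)"
  have "p dvd (a * l0 - 1) * s" using l0 by (simp add: cong_iff_dvd_diff)
  then have "m * p dvd m * ((a * l0 - 1) * s)" by simp
  moreover have "m * ((a * l0 - 1) * s) = a * u' - X"
    using s by (simp add: u'_def algebra_simps)
  ultimately have c: "[a * u' = X] (mod (m * p))" by (simp add: cong_iff_dvd_diff)
  have c': "[u' = u] (mod m)" by (simp add: u'_def cong_def)
  have "coprime u' m" using c' u by (metis cong_imp_coprime cong_sym)
  moreover have "\<not> p dvd u'"
  proof
    assume "p dvd u'"
    moreover have "p dvd a * u' - X" using c by (metis cong_iff_dvd_diff dvd_mult_right)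
    ultimately show False using X(2) by (metis dvd_diff_right_iff dvd_mult)
  qed
  then have "coprime u' p" using p by (metis coprime_commute prime_imp_coprime)
  ultimately show ?thesis using c c' by auto
qed

text \<open>A multiple of \<open>m\<close> in the argument gains the factor \<open>p\<close> from
  \<open>c\<close> and vanishes modulo \<open>m * p\<close>.\<close>

lemma mult_mod_cong_fibre:
  fixes c p m u u' :: int
  assumes "p dvd c" "[u' = u] (mod m)"
  shows "(c * u') mod (m * p) = (c * u) mod (m * p)"
proof -
  obtain e where e: "c = p * e" using assms(1) by blast
  have "m dvd u' - u" using assms(2) by (simp add: cong_iff_dvd_diff)
  then have "m * p dvd (u' - u) * p" by simp
  then have "m * p dvd (u' - u) * p * e" by (rule dvd_mult2)
  then have "[c * u' = c * u] (mod (m * p))"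
    by (simp add: cong_iff_dvd_diff e algebra_simps)
  then show ?thesis by (simp add: cong_def)
qed

section \<open>A prime dividing two of the entries\<close>

lemma not_balanced_if_prime_dvd_two:
  fixes n m p a b c d :: int
  assumes p: "prime p" and n: "n > 0" "n = m * p" "coprime n 6"
    and bal: "balanced n a b c d"
    and dvd: "\<not> p dvd a" "p dvd c" "p dvd d" and ab: "\<not> n dvd a + b"
  shows False
proof -
  have p0: "p > 0" using p by (simp add: prime_gt_0_int)
  have m: "m > 0" using n p0 by (simp add: zero_less_mult_iff)
  have "coprime p 6" using n by simp
  then have p5: "p \<ge> 5" using ge_5_if_coprime_6 p prime_gt_1_int by blast
  define g M where "g = gcd (a + b) n" and "M = n div g"
  have nM: "n = g * M" and M6: "coprime M 6" and M: "M \<ge> 5" and g: "g > 0" "5 * g \<le> n"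
    using coprime_6_gcd_quotient[OF n(1,3) ab] by (auto simp: g_def M_def)
  \<comment> \<open>The unit \<open>u\<close> chosen below makes \<open>u (a + b) / n\<close> congruent to \<open>1/2 - 1/(2 M)\<close> modulo \<open>1\<close>, which is at least
    \<open>2/5\<close> away from the integers, whereas \<open>T / n\<close> is within \<open>2 / p\<close> of \<open>1\<close>.\<close>
  define k where "k = (M - 1) div 2"
  have "odd M" using M6 by (simp add: coprime_6_int_iff)
  then have k: "2 * k = M - 1" by (simp add: k_def)
  have "coprime k M"
  proof (rule coprimeI)
    fix e assume "e dvd k" "e dvd M"
    then have "e dvd M - 2 * k" by simp
    then show "is_unit e" using k by simp
  qed
  then obtain u where u: "coprime u n" "[u * (a + b) = k * g] (mod n)"
    using unit_multiple_eq_gcd_multiple[OF n(1)] by (auto simp: g_def M_def)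
  define T where "T = (a * u) mod n + (b * u) mod n"
  \<comment> \<open>Moving \<open>u\<close> within its class so that the first residue becomes
    \<open>X\<close> keeps the residues of \<open>c\<close> and \<open>d\<close>, hence also
    \<open>T\<close>; the second residue is then \<open>T - X\<close>, which lies in
    \<open>{0..<n}\<close>.\<close>
  have T_bounds: "X \<le> T \<and> T < X + n"
    if X: "[X = a * u] (mod m)" "\<not> p dvd X" "0 \<le> X" "X < n" for X
  proof -
    have um: "coprime u m" using u(1) n by simp
    obtain u' where u': "coprime u' n" "[u' = u] (mod m)" "[a * u' = X] (mod n)"
      using unit_in_fibre[OF p um dvd(1) X(1,2)] n by auto
    have "(a * u') mod n = X" using u'(3) X(3,4) by (simp add: cong_def)
    moreover have "(c * u') mod n = (c * u) mod n" "(d * u') mod n = (d * u) mod n"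
      using mult_mod_cong_fibre[OF _ u'(2)] dvd n by auto
    moreover have "(a * u) mod n + (b * u) mod n + (c * u) mod n + (d * u) mod n = 2 * n"
      "(a * u') mod n + (b * u') mod n + (c * u') mod n + (d * u') mod n = 2 * n"
      using bal u(1) u'(1) by (auto simp: balanced_def)
    ultimately have "T = X + (b * u') mod n" by (simp add: T_def)
    then show ?thesis using n(1) by simp
  qed
  define r where "r = (a * u) mod m"
  have r: "0 \<le> r" "r < m" using m by (auto simp: r_def)
  have cr: "[r + m * j = a * u] (mod m)" for j by (simp add: r_def cong_def)
  \<comment> \<open>The candidates for \<open>X\<close> are the \<open>r + m * j\<close>. Of two
    neighbours at least one is admissible, so one of the two largest bounds \<open>T\<close> from
    below and one of the two smallest bounds it from above.\<close>
  have one: "\<not> p dvd r + m * j \<or> \<not> p dvd r + m * (j + 1)" for j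
  proof (rule ccontr)
    assume "\<not> ?thesis"
    then have *: "p dvd r + m * j" "p dvd r + m * (j + 1)" by auto
    then have "p dvd (r + m * (j + 1)) - (r + m * j)" by (rule dvd_diff[rotated])
    then have pm: "p dvd m" by (simp add: algebra_simps)
    then have "p dvd r" using *(1) by (metis dvd_add_left_iff dvd_mult2)
    then have "p dvd a * u" using pm r_def by (metis dvd_mod_iff)
    then have "p dvd u" using dvd(1) p prime_dvd_multD by blast
    then show False using u(1) n p by (metis coprime_common_divisor dvd_triv_right not_prime_unit)
  qed
  have nmp: "n = m * (p - 2) + 2 * m" "m * (p - 2) \<ge> m * 3"
    using n p5 m by (auto simp: algebra_simps)
  have lower: "T \<ge> n - 2 * m"
  proof (cases "p dvd r + m * (p - 2)")
    case True
    then have "\<not> p dvd r + m * (p - 1)" using one[of "p - 2"] by simp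
    moreover have e: "m * (p - 1) = n - m" using n by (simp add: algebra_simps)
    ultimately have "T \<ge> r + m * (p - 1)" using T_bounds[OF cr, of "p - 1"] r m nmp by simp
    then show ?thesis using r m unfolding e by simp
  next
    case False
    then have "T \<ge> r + m * (p - 2)" using T_bounds[OF cr] r m nmp by simp
    then show ?thesis using r nmp by simp
  qed
  have upper: "T < n + 2 * m"
  proof (cases "p dvd r + m * 0")
    case True
    then have "\<not> p dvd r + m * 1" using one[of 0] by simp
    then have "T < r + m * 1 + n" using T_bounds[OF cr[of 1]] r m nmp by simp
    then show ?thesis using r by simp
  next
    case False
    then have "T < r + m * 0 + n" using T_bounds[OF cr[of 0]] r m nmp by simp
    then show ?thesis using r by simp
  qed
  have "[T = a * u + b * u] (mod n)" by (simp add: T_def cong_def mod_simps)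
  then have "[T = u * (a + b)] (mod n)" by (simp add: algebra_simps)
  then have "[k * g = T] (mod n)" using u(2) cong_trans cong_sym by blast
  then obtain i where i: "T = k * g + n * i" unfolding cong_iff_lin by blast
  have "2 * (k * g) = (M - 1) * g" using k by simp
  then have "2 * (k * g) = n - g" using nM by (simp add: algebra_simps)
  then have T2: "2 * T = n - g + 2 * (n * i)" using i by simp
  have "5 * m \<le> n" using nmp by simp
  \<comment> \<open>The value \<open>2 * T\<close> is \<open>n - g\<close> plus a multiple of
    \<open>2 * n\<close>. It is at most \<open>n\<close> if \<open>i \<le> 0\<close> and at least
    \<open>14 * n / 5\<close> otherwise, but the bounds on \<open>T\<close> place it in the
    half-open interval from \<open>6 * n / 5\<close> to \<open>14 * n / 5\<close>.\<close>
  show False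
  proof (cases "i \<le> 0")
    case True
    then have "n * i \<le> 0" using n(1) by (simp add: mult_le_0_iff)
    then show False using T2 lower \<open>5 * m \<le> n\<close> g by linarith
  next
    case False
    then have "n * 1 \<le> n * i" using n(1) by (intro mult_left_mono) auto
    then show False using T2 upper \<open>5 * m \<le> n\<close> g by linarith
  qed
qed

section \<open>A prime dividing exactly one of the entries\<close>

text \<open>As \<open>p\<close> divides \<open>m\<close>, the whole class of a unit \<open>u\<close>
  modulo \<open>m\<close> consists of units modulo \<open>n\<close>. Summing the balance over it
  gives \<open>n < 3 * m + 2 * g\<close>, where \<open>g\<close> is the fourth residue; this fails
  because \<open>m\<close> and \<open>g\<close> are at most \<open>n / 5\<close>.\<close>

lemma not_balanced_if_prime_square_dvd:
  fixes n m p a b c d :: int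
  assumes p: "prime p" and n: "n > 0" "n = m * p" "coprime n 6" and pm: "p dvd m"
    and bal: "balanced n a b c d"
    and dvd: "\<not> p dvd a" "\<not> p dvd b" "\<not> p dvd c" "p dvd d" "\<not> n dvd d"
  shows False
proof -
  have p0: "p > 0" using p by (simp add: prime_gt_0_int)
  have m: "m > 0" using n p0 by (simp add: zero_less_mult_iff)
  have "coprime p 6" using n by simp
  then have p5: "p \<ge> 5" using ge_5_if_coprime_6 p prime_gt_1_int by blast
  have cop: "coprime a p" "coprime b p" "coprime c p"
    using dvd p by (metis coprime_commute prime_imp_coprime)+
  define g where "g = gcd d n"
  have g: "g > 0" "5 * g \<le> n"
    using coprime_6_gcd_quotient[OF n(1,3) dvd(5)] by (auto simp: g_def)
  \<comment> \<open>This unit makes the fourth residue as small as possible, namely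
    \<open>gcd d n\<close>.\<close>
  obtain u where u: "coprime u n" "[u * d = 1 * g] (mod n)"
    using unit_multiple_eq_gcd_multiple[OF n(1), of 1 d] by (auto simp: g_def)
  have du: "(d * u) mod n = g" using u(2) g by (simp add: cong_def mult.commute)
  have each: "(a * (u + m * l)) mod n + (b * (u + m * l)) mod n + (c * (u + m * l)) mod n + g = 2 * n"
    for l
  proof -
    have "[u + m * l = u] (mod m)" by (simp add: cong_def)
    then have "(d * (u + m * l)) mod n = g"
      using mult_mod_cong_fibre[OF dvd(4)] du n by simp
    moreover have "coprime (u + m * l) m" "coprime (u + m * l) p"
    proof -
      show "coprime (u + m * l) m" using u(1) n
        by (metis \<open>[u + m * l = u] (mod m)\<close> cong_imp_coprime cong_sym coprime_mult_right_iff)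
      then show "coprime (u + m * l) p" using pm by (meson coprime_divisors dvd_refl)
    qed
    then have "coprime (u + m * l) n" using n by simp
    ultimately show ?thesis using bal by (auto simp: balanced_def)
  qed
  \<comment> \<open>A pure rearrangement: it exposes the common factor \<open>p\<close> once the
    three sums over the class have been evaluated.\<close>
  have collect: "p * (2 * (x + y + z) + 3 * (m * (p - 1)) + 2 * g) = p * (4 * n)"
    if "2 * p * x + m * (p * (p - 1)) + (2 * p * y + m * (p * (p - 1)))
      + (2 * p * z + m * (p * (p - 1))) + 2 * (p * g) = 2 * (p * (2 * n))" for x y z
  proof -
    have "p * (2 * (x + y + z) + 3 * (m * (p - 1)) + 2 * g)
        = 2 * p * x + m * (p * (p - 1)) + (2 * p * y + m * (p * (p - 1)))
          + (2 * p * z + m * (p * (p - 1))) + 2 * (p * g)"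
      by (simp add: algebra_simps)
    then show ?thesis using that by simp
  qed
  have "(\<Sum>l\<in>{0..<p}. (a * (u + m * l)) mod n + (b * (u + m * l)) mod n + (c * (u + m * l)) mod n + g)
      = p * (2 * n)" using p0 by (simp add: each)
  then have "2 * (\<Sum>l\<in>{0..<p}. (a * (u + m * l)) mod (m * p)) + 2 * (\<Sum>l\<in>{0..<p}. (b * (u + m * l)) mod (m * p))
      + 2 * (\<Sum>l\<in>{0..<p}. (c * (u + m * l)) mod (m * p)) + 2 * (p * g) = 2 * (p * (2 * n))"
    using p0 n(2) by (simp add: sum.distrib)
  then have "p * (2 * ((a * u) mod m + (b * u) mod m + (c * u) mod m) + 3 * (m * (p - 1)) + 2 * g) = p * (4 * n)"
    unfolding sum_residues_over_fibre[OF m p0 cop(1)] sum_residues_over_fibre[OF m p0 cop(2)]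
      sum_residues_over_fibre[OF m p0 cop(3)]
    by (rule collect)
  then have eq: "2 * ((a * u) mod m + (b * u) mod m + (c * u) mod m) + 3 * (m * (p - 1)) + 2 * g = 4 * n"
    using p0 by simp
  define r where "r = (a * u) mod m + (b * u) mod m + (c * u) mod m"
  have "r < m + m + m" unfolding r_def using m by (intro add_strict_mono) auto
  moreover have "3 * (m * (p - 1)) = 3 * n - 3 * m" using n by (simp add: algebra_simps)
  ultimately have "n < 3 * m + 2 * g" 
    using eq unfolding r_def[symmetric] by linarith
  moreover have "m * 5 \<le> n" using n m p5 by simp
  ultimately show False using g by linarith
qed

text \<open>The sum of the four residues modulo \<open>n\<close> over the class of
  \<open>p * w\<close> modulo \<open>m\<close> is computed twice. Units contribute
  \<open>2 * n\<close> each and \<open>p * w\<close> itself contributes \<open>p * A w\<close>; on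
  the other hand \<open>sum_residues_over_fibre\<close> handles \<open>a\<close>, \<open>b\<close>,
  \<open>c\<close>, and the residue of \<open>d\<close> is constantly
  \<open>p * ((d * w) mod m)\<close>. Reducing this constant modulo \<open>m\<close> completes
  \<open>A (p * w)\<close>, and its quotient by \<open>m\<close> is the subtracted term.\<close>

lemma residue_sum_step:
  fixes n m p a b c d w :: int
  assumes p: "prime p" and n: "n > 0" "n = m * p" "coprime n 6" and pm: "\<not> p dvd m"
    and bal: "balanced n a b c d"
    and dvd: "\<not> p dvd a" "\<not> p dvd b" "\<not> p dvd c" "p dvd d" and w: "coprime w m"
  defines "A \<equiv> \<lambda>w. (a * w) mod m + (b * w) mod m + (c * w) mod m + (d * w) mod m"
  shows "A (p * w) = A w + m * ((p - 1) div 2 - (p * ((d * w) mod m)) div m)"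
proof -
  have p0: "p > 0" using p by (simp add: prime_gt_0_int)
  have m: "m > 0" using n p0 by (simp add: zero_less_mult_iff)
  have cop: "coprime a p" "coprime b p" "coprime c p"
    using dvd p by (metis coprime_commute prime_imp_coprime)+
  define G where "G l = (a * (p * w + m * l)) mod (m * p) + (b * (p * w + m * l)) mod (m * p)
    + (c * (p * w + m * l)) mod (m * p) + (d * (p * w + m * l)) mod (m * p)" for l
  define X where "X = (d * (p * w)) mod (m * p)"
  have X: "X = p * ((d * w) mod m)"
    by (simp add: X_def mult.left_commute[of _ p] mult.commute[of m p])
  \<comment> \<open>The class of \<open>p w\<close> modulo \<open>m\<close> contains exactly one non-unit modulo \<open>n\<close>, namely \<open>p w\<close> itself.\<close>
  have G0: "G 0 = p * A w"
    by (simp add: G_def A_def mult.left_commute[of _ p] mult.commute[of m p] distrib_left)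
  have Gl: "G l = 2 * n" if l: "l \<in> {1..<p}" for l
  proof -
    have "coprime p m" using p pm by (simp add: prime_imp_coprime)
    then have "coprime (p * w) m" using w by simp
    moreover have "[p * w + m * l = p * w] (mod m)" by (simp add: cong_def)
    ultimately have 1: "coprime (p * w + m * l) m" by (metis cong_imp_coprime cong_sym)
    have "\<not> p dvd l" using l zdvd_not_zless by auto
    then have "\<not> p dvd m * l" using p pm prime_dvd_multD by blast
    then have "\<not> p dvd p * w + m * l" by (simp add: dvd_add_right_iff)
    then have "coprime (p * w + m * l) p" using p by (metis coprime_commute prime_imp_coprime)
    then have "coprime (p * w + m * l) n" using 1 n by simp
    then show ?thesis using bal n by (simp add: balanced_def G_def)
  qed
  have collect: "p * (2 * A w + 4 * (m * (p - 1))) = p * (2 * (x + y + z) + 3 * (m * (p - 1)) + 2 * X)"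
    if "S = p * A w + (p - 1) * (2 * (m * p))"
      "2 * S = 2 * p * x + m * (p * (p - 1)) + (2 * p * y + m * (p * (p - 1)))
      + (2 * p * z + m * (p * (p - 1))) + 2 * (p * X)" for x y z S
  proof -
    have "p * (2 * (x + y + z) + 3 * (m * (p - 1)) + 2 * X)
        = 2 * p * x + m * (p * (p - 1)) + (2 * p * y + m * (p * (p - 1)))
          + (2 * p * z + m * (p * (p - 1))) + 2 * (p * X)"
      by (simp add: algebra_simps)
    also have "\<dots> = 2 * S" using that(2) by simp
    also have "\<dots> = p * (2 * A w + 4 * (m * (p - 1)))" using that(1) by (simp add: algebra_simps)
    finally show ?thesis by (rule sym)
  qed
  have "{0..<p} = insert 0 {1..<p}" using p0 by auto
  then have "(\<Sum>l\<in>{0..<p}. G l) = p * A w + (p - 1) * (2 * n)"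
    using p0 by (simp add: G0 Gl)
  moreover have "2 * (\<Sum>l\<in>{0..<p}. G l)
    = 2 * (\<Sum>l\<in>{0..<p}. (a * (p * w + m * l)) mod (m * p)) + 2 * (\<Sum>l\<in>{0..<p}. (b * (p * w + m * l)) mod (m * p))
      + 2 * (\<Sum>l\<in>{0..<p}. (c * (p * w + m * l)) mod (m * p)) + 2 * (p * X)"
  proof -
    have "(d * (p * w + m * l)) mod (m * p) = X" for l
      unfolding X_def by (rule mult_mod_cong_fibre[OF dvd(4)]) (simp add: cong_def)
    then show ?thesis using p0 by (simp add: G_def sum.distrib)
  qed
  ultimately have "p * (2 * A w + 4 * (m * (p - 1)))
    = p * (2 * ((a * (p * w)) mod m + (b * (p * w)) mod m + (c * (p * w)) mod m) + 3 * (m * (p - 1)) + 2 * X)"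
    unfolding sum_residues_over_fibre[OF m p0 cop(1)] sum_residues_over_fibre[OF m p0 cop(2)]
      sum_residues_over_fibre[OF m p0 cop(3)] n(2)
    by (rule collect)
  then have eq: "2 * A w + m * (p - 1) = 2 * ((a * (p * w)) mod m + (b * (p * w)) mod m + (c * (p * w)) mod m) + 2 * X"
    using p0 by simp
  have "X mod m = (d * (p * w)) mod m" unfolding X_def by (rule mod_mod_cancel) simp
  then have A: "A (p * w) = (a * (p * w)) mod m + (b * (p * w)) mod m + (c * (p * w)) mod m + X mod m"
    by (simp add: A_def)
  have Xd: "m * (X div m) = X - X mod m" by (simp add: minus_mod_eq_mult_div)
  have "odd p" using n(2,3) by (simp add: coprime_6_int_iff)
  then have "2 * ((p - 1) div 2) = p - 1" by simp
  then have "m * (2 * ((p - 1) div 2)) = m * (p - 1)" by simp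
  then have "2 * (m * ((p - 1) div 2)) = m * (p - 1)" by (simp only: mult.left_commute)
  then show ?thesis using eq A Xd by (simp add: X right_diff_distrib)
qed

text \<open>Here \<open>\<alpha> j\<close> stands for the residue sum at \<open>p ^ j * w\<close> in
  units of \<open>m\<close>. Two values can differ by at most 2, but a few consecutive increments
  always add up to at least 3 in absolute value. For \<open>p \<ge> 11\<close> the first increment
  suffices, since \<open>M \<ge> 5\<close>.\<close>

lemma no_bounded_orbit:
  fixes p M :: int and \<alpha> :: "nat \<Rightarrow> int"
  assumes p: "prime p" "coprime p 6" and M: "coprime M 6" "M \<ge> 5" "coprime M p"
    and step: "\<And>j. \<alpha> (Suc j) = \<alpha> j + (p - 1) div 2 - (p * (p ^ j mod M)) div M"
    and range: "\<And>j. 1 \<le> \<alpha> j \<and> \<alpha> j \<le> 3"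
  shows False
proof -
  have p5: "p \<ge> 5" using ge_5_if_coprime_6 p prime_gt_1_int by blast
  have "p \<noteq> 6" "p \<noteq> 8" "p \<noteq> 9" "p \<noteq> 10" using p(2) by (auto simp: coprime_6_int_iff)
  then consider "p \<ge> 11" | "p = 7" | "p = 5" using p5 by linarith
  then show False
  proof cases
    case 1
    have "p div M \<le> p div 5" using M(2) 1 by (intro zdiv_mono2) auto
    moreover have "p div 5 + 3 \<le> (p - 1) div 2" using 1 by presburger
    moreover have "\<alpha> 1 = \<alpha> 0 + (p - 1) div 2 - p div M" using step[of 0] M(2) by simp
    ultimately show False using range[of 0] range[of 1] by linarith
  next
    \<comment> \<open>For \<open>M = 5\<close> the first two increments are 2 and 1; for
      \<open>M \<ge> 8\<close> the first one is already 3.\<close>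
    case 2
    have "M \<noteq> 6" "M \<noteq> 7" using M 2 by (auto simp: coprime_6_int_iff)
    then consider "M = 5" | "M \<ge> 8" using M(2) by linarith
    then show False
    proof cases
      assume "M = 5"
      then show False using step[of 0] step[of 1] range[of 0] range[of 2] 2
        by (simp add: numeral_2_eq_2)
    next
      assume "M \<ge> 8"
      then show False using step[of 0] range[of 0] range[of 1] 2 by simp
    qed
  next
    \<comment> \<open>For \<open>M = 7\<close> the increments at 1, 2, 3 are -1, 0, -2. For
      \<open>M = 11\<close> the first three are 2, 0, 1. For \<open>M \<ge> 13\<close> the first is
      2 and the second at least 1.\<close>
    case 3
    have "M \<noteq> 5" "M \<noteq> 6" "M \<noteq> 8" "M \<noteq> 9" "M \<noteq> 10" "M \<noteq> 12"
      using M 3 by (auto simp: coprime_6_int_iff)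
    then consider "M = 7" | "M = 11" | "M \<ge> 13" using M(2) by linarith
    then show False
    proof cases
      assume "M = 7"
      then show False using step[of 1] step[of 2] step[of 3] range[of 1] range[of 4] 3
        by (simp add: numeral_eq_Suc)
    next
      assume "M = 11"
      then show False using step[of 0] step[of 1] step[of 2] range[of 0] range[of 3] 3
        by (simp add: numeral_eq_Suc)
    next
      assume M13: "M \<ge> 13"
      have "(25::int) div M \<le> 25 div 13" using M13 by (intro zdiv_mono2) auto
      then show False using step[of 0] step[of 1] range[of 0] range[of 2] 3 M13
        by (simp add: numeral_2_eq_2)
    qed
  qed
qed

lemma not_balanced_if_prime_dvd_one:
  fixes n m p a b c d :: int
  assumes p: "prime p" and n: "n > 0" "n = m * p" "coprime n 6"
    and bal: "balanced n a b c d"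
    and dvd: "\<not> p dvd a" "\<not> p dvd b" "\<not> p dvd c" "p dvd d" "\<not> n dvd d"
  shows False
proof (cases "p dvd m")
  case True
  then show False using not_balanced_if_prime_square_dvd assms by blast
next
  case pm: False
  have p0: "p > 0" using p by (simp add: prime_gt_0_int)
  have m: "m > 0" using n p0 by (simp add: zero_less_mult_iff)
  have cpm: "coprime p m" using p pm by (simp add: prime_imp_coprime)
  have md: "\<not> m dvd d" using cpm dvd(4,5) n by (metis divides_mult mult.commute)
  have m6: "coprime m 6" and p6: "coprime p 6" using n by auto
  define g M where "g = gcd d m" and "M = m div g"
  have mM: "m = g * M" and M6: "coprime M 6" and M: "M \<ge> 5" and g: "g > 0" "5 * g \<le> m"
    using coprime_6_gcd_quotient[OF m m6 md] by (auto simp: g_def M_def)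
  have Mp: "coprime M p" using cpm mM by (simp add: coprime_commute)
  obtain w where w: "coprime w m" "[w * d = 1 * g] (mod m)"
    using unit_multiple_eq_gcd_multiple[OF m, of 1 d] by (auto simp: g_def)
  define A where "A w = (a * w) mod m + (b * w) mod m + (c * w) mod m + (d * w) mod m" for w
  define v where "v j = p ^ j * w" for j :: nat
  define \<alpha> where "\<alpha> j = A (v j) div m" for j
  have v: "coprime (v j) m" for j using cpm w by (simp add: v_def)
  \<comment> \<open>The choice of \<open>w\<close> turns the orbit of the fourth residue into the
    powers of \<open>p\<close> modulo \<open>M\<close>, scaled by \<open>g\<close>, so that the
    increments of \<open>\<alpha>\<close> depend only on \<open>p\<close> and
    \<open>M\<close>.\<close>
  have dv: "(d * v j) mod m = g * (p ^ j mod M)" for j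
  proof -
    have "[p ^ j * (w * d) = p ^ j * (1 * g)] (mod m)" using w(2) by (rule cong_scalar_left)
    then have "(d * v j) mod m = (g * p ^ j) mod (g * M)"
      by (simp add: v_def cong_def mM algebra_simps)
    then show ?thesis by simp
  qed
  have Adiv: "m dvd A (v j)" for j
  proof -
    have "m dvd a + b + c + d" using balanced_dvd_sum[OF bal] n by (metis dvd_mult_left)
    then have "m dvd (a + b + c + d) * v j" by simp
    then show ?thesis unfolding A_def dvd_sum_residues_iff by (simp add: algebra_simps)
  qed
  then have Am: "A (v j) = m * \<alpha> j" for j by (simp add: \<alpha>_def)
  \<comment> \<open>The fourth residue is nonzero because \<open>p ^ j\<close> is prime to
    \<open>M > 1\<close>; this excludes the value 0.\<close>
  have range: "1 \<le> \<alpha> j \<and> \<alpha> j \<le> 3" for j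
  proof -
    have "coprime (p ^ j) M" using Mp by (simp add: coprime_commute)
    moreover have "\<not> is_unit M" using M by simp
    ultimately have "\<not> M dvd p ^ j" using coprime_absorb_right by blast
    then have "p ^ j mod M \<noteq> 0" by (simp add: dvd_eq_mod_eq_0)
    moreover have "p ^ j mod M \<ge> 0" using M by simp
    ultimately have "p ^ j mod M > 0" by linarith
    then have "(d * v j) mod m > 0" using g by (simp add: dv)
    then have "A (v j) > 0" using m unfolding A_def
      by (intro add_nonneg_pos add_nonneg_nonneg) auto
    moreover have "A (v j) < m + m + m + m" unfolding A_def
      using m by (intro add_strict_mono) auto
    ultimately have "m * 0 < m * \<alpha> j" "m * \<alpha> j < m * 4" unfolding Am by linarith+
    then have "0 < \<alpha> j \<and> \<alpha> j < 4"
      using mult_less_cancel_left_pos[OF m] by blast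
    then show ?thesis by simp
  qed
  have "\<alpha> (Suc j) = \<alpha> j + (p - 1) div 2 - (p * (p ^ j mod M)) div M" for j
  proof -
    have "A (p * v j) = A (v j) + m * ((p - 1) div 2 - (p * ((d * v j) mod m)) div m)"
      unfolding A_def by (rule residue_sum_step[OF p n pm bal dvd(1-4) v])
    moreover have "(p * ((d * v j) mod m)) div m = (p * (p ^ j mod M)) div M"
      unfolding dv using g by (simp add: mM mult.left_commute[of p g])
    moreover have "p * v j = v (Suc j)" by (simp add: v_def)
    ultimately have "m * \<alpha> (Suc j) = m * \<alpha> j + m * ((p - 1) div 2 - (p * (p ^ j mod M)) div M)"
      by (simp only: Am)
    then have "m * \<alpha> (Suc j) = m * (\<alpha> j + ((p - 1) div 2 - (p * (p ^ j mod M)) div M))"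
      by (simp only: distrib_left)
    then show ?thesis using m by simp
  qed
  then show False by (rule no_bounded_orbit[OF p p6 M6 M Mp _ range])
qed

section \<open>The index in terms of least residues\<close>

lemma generators_eq: "generators n = {g \<in> {1..int n}. coprime g (int n)}"
proof -
  have "(\<forall>a. \<exists>m. [m * g = a] (mod int n)) \<longleftrightarrow> coprime g (int n)" for g
  proof
    assume "\<forall>a. \<exists>m. [m * g = a] (mod int n)"
    then obtain m where "[m * g = 1] (mod int n)" by blast
    then show "coprime g (int n)"
      by (metis cong_imp_coprime cong_sym coprime_1_left coprime_mult_left_iff)
  next
    assume "coprime g (int n)"
    then obtain v where v: "[g * v = 1] (mod int n)" using cong_solve_coprime_int by blast
    show "\<forall>a. \<exists>m. [m * g = a] (mod int n)"
    proof
      fix a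
      have "[a * (g * v) = a * 1] (mod int n)" using v by (rule cong_scalar_left)
      then have "[(a * v) * g = a] (mod int n)" by (simp add: mult.assoc mult.commute[of v g])
      then show "\<exists>m. [m * g = a] (mod int n)" ..
    qed
  qed
  then show ?thesis by (simp add: generators_def)
qed

lemma finite_generators: "finite (generators n)"
  by (rule finite_subset[of _ "{1..int n}"]) (auto simp: generators_eq)

lemma generator_inverse:
  assumes "g \<in> generators n"
  obtains u where "coprime u (int n)" "[u * g = 1] (mod int n)"
proof -
  have "coprime g (int n)" using assms by (simp add: generators_eq)
  then obtain u where u: "[g * u = 1] (mod int n)" using cong_solve_coprime_int by blast
  then have "coprime u (int n)"
    by (metis cong_imp_coprime cong_sym coprime_1_left coprime_mult_left_iff)
  then show ?thesis using that u by (simp add: mult.commute)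
qed

lemma unit_has_generator_inverse:
  assumes "n > 0" "coprime u (int n)"
  obtains g where "g \<in> generators n" "[u * g = 1] (mod int n)"
proof -
  obtain v where v: "[u * v = 1] (mod int n)" using assms(2) cong_solve_coprime_int by blast
  define g where "g = (v - 1) mod int n + 1"
  have gv: "[g = v] (mod int n)" by (simp add: g_def cong_def mod_add_left_eq)
  then have ug: "[u * g = 1] (mod int n)" using v cong_scalar_left cong_trans by blast
  then have "coprime g (int n)"
    by (metis cong_imp_coprime cong_sym coprime_1_left coprime_mult_left_iff)
  moreover have "g \<in> {1..int n}" using assms(1) by (simp add: g_def add1_zle_eq)
  ultimately have "g \<in> generators n" by (simp add: generators_eq)
  then show ?thesis using that ug by blast
qed

text \<open>The coefficient is the residue of \<open>a\<close> times the inverse of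
  \<open>g\<close>. The two ranges \<open>{1..n}\<close> and \<open>{0..<n}\<close> disagree only at
  the zero class, which is excluded.\<close>

lemma coefficient_eq_mod:
  assumes n: "n > 0" and g: "g \<in> generators n" and u: "[u * g = 1] (mod int n)"
    and a: "\<not> int n dvd a"
  shows "coefficient n g a = (a * u) mod int n"
proof -
  have "coprime u (int n)"
    using u by (metis cong_imp_coprime cong_sym coprime_1_left coprime_mult_left_iff)
  then have "\<not> int n dvd a * u" using a
    by (simp add: coprime_commute coprime_dvd_mult_left_iff)
  then have "(a * u) mod int n \<noteq> 0" by (simp add: dvd_eq_mod_eq_0)
  moreover have "(a * u) mod int n \<ge> 0" "(a * u) mod int n < int n" using n by simp_all
  ultimately have "(a * u) mod int n \<in> {1..int n}" by simp
  moreover have "[(a * u) mod int n * g = a] (mod int n)"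
  proof -
    have "[a * (u * g) = a * 1] (mod int n)" using u by (rule cong_scalar_left)
    then show ?thesis by (simp add: cong_def mod_mult_left_eq mult.assoc)
  qed
  ultimately show ?thesis unfolding coefficient_def
    by (intro the1_equality[OF coefficient_unique[OF g]]) blast
qed

lemma seq_norm_eq_residue_sum:
  assumes "n > 0" "g \<in> generators n" "[u * g = 1] (mod int n)"
    and "\<not> int n dvd a" "\<not> int n dvd b" "\<not> int n dvd c" "\<not> int n dvd d"
  shows "seq_norm n g {#a, b, c, d#} =
    of_int ((a * u) mod int n + (b * u) mod int n + (c * u) mod int n + (d * u) mod int n) / of_nat n"
  using assms by (simp add: seq_norm_def coefficient_eq_mod add.assoc)

lemma balanced_if_index_2:
  assumes n: "n > 0"
    and nd: "\<not> int n dvd a" "\<not> int n dvd b" "\<not> int n dvd c" "\<not> int n dvd d"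
    and ind: "seq_index n {#a, b, c, d#} = 2"
  shows "balanced (int n) a b c d"
proof -
  define R where "R u = (a * u) mod int n + (b * u) mod int n + (c * u) mod int n + (d * u) mod int n"
    for u
  have ge: "R u \<ge> 2 * int n" if u: "coprime u (int n)" for u
  proof -
    obtain g where g: "g \<in> generators n" "[u * g = 1] (mod int n)"
      using unit_has_generator_inverse[OF n u] by blast
    have "2 \<le> seq_norm n g {#a, b, c, d#}"
      unfolding ind[symmetric] seq_index_def using g(1) finite_generators by (intro Min_le) auto
    also have "\<dots> = of_int (R u) / of_nat n"
      unfolding R_def by (rule seq_norm_eq_residue_sum[OF n g nd])
    finally have "real_of_int (2 * int n) \<le> of_int (R u)" using n by (simp add: field_simps)
    then show ?thesis by (simp only: of_int_le_iff)
  qed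
  have neg: "(x * - u) mod int n = int n - (x * u) mod int n"
    if "\<not> int n dvd x" "coprime u (int n)" for x u
  proof -
    have "\<not> int n dvd x * u" using that
      by (simp add: coprime_commute coprime_dvd_mult_left_iff)
    then show ?thesis by (simp add: zmod_zminus1_eq_if dvd_eq_mod_eq_0)
  qed
  have "R u = 2 * int n" if u: "coprime u (int n)" for u
  proof -
    have "R (- u) = 4 * int n - R u" unfolding R_def using nd u by (simp add: neg del: mult_minus_right)
    moreover have "R (- u) \<ge> 2 * int n" using u by (intro ge) simp
    ultimately show ?thesis using ge[OF u] by linarith
  qed
  then show ?thesis by (simp add: balanced_def R_def)
qed

text \<open>This converse certifies that a smaller modulus, reached by dividing out a common prime,
  is again exceptional.\<close>

lemma index_2_if_balanced:
  assumes n: "n > 0"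
    and nd: "\<not> int n dvd a" "\<not> int n dvd b" "\<not> int n dvd c" "\<not> int n dvd d"
    and bal: "balanced (int n) a b c d"
  shows "seq_index n {#a, b, c, d#} = 2"
proof -
  have "seq_norm n g {#a, b, c, d#} = 2" if g: "g \<in> generators n" for g
  proof -
    obtain u where u: "coprime u (int n)" "[u * g = 1] (mod int n)" using generator_inverse[OF g] .
    then have "(a * u) mod int n + (b * u) mod int n + (c * u) mod int n + (d * u) mod int n = 2 * int n"
      using bal by (simp add: balanced_def)
    then show ?thesis
      using seq_norm_eq_residue_sum[OF n g u(2) nd] n by (simp del: of_int_add)
  qed
  moreover have "generators n \<noteq> {}"
    using unit_has_generator_inverse[OF n, of 1] by force
  ultimately have "(\<lambda>g. seq_norm n g {#a, b, c, d#}) ` generators n = {2}" by auto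
  then show ?thesis by (simp add: seq_index_def)
qed

section \<open>Minimal zero-sum sequences and division by a common prime\<close>

lemma minimal_zero_sum_not_dvd:
  assumes "minimal_zero_sum n S" "T \<subset># S" "T \<noteq> {#}"
  shows "\<not> int n dvd \<Sum>\<^sub># T"
proof -
  have "set_mset T \<subseteq> set_mset S" using assms(2) by (simp add: set_mset_mono subset_mset.less_imp_le)
  then show ?thesis
    using assms by (auto simp: minimal_zero_sum_def zero_sum_def cong_0_iff)
qed

text \<open>Multiplication by \<open>p\<close> identifies the integers modulo \<open>m\<close> with
  the multiples of \<open>p\<close> modulo \<open>m * p\<close>, and the representatives in
  \<open>{1..m}\<close> with the multiples of \<open>p\<close> in \<open>{1..m * p}\<close>. Zero
  sums correspond in both directions.\<close>

lemma minimal_zero_sum_scale: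
  assumes "m > 0" "p > 0" "minimal_zero_sum (m * p) (image_mset ((*) (int p)) S)"
  shows "minimal_zero_sum m S"
proof -
  have zs: "zero_sum (m * p) (image_mset ((*) (int p)) T) \<longleftrightarrow> zero_sum m T" for T
  proof -
    have "1 \<le> int p * x \<longleftrightarrow> 1 \<le> x" for x
      using assms(2) by (metis int_one_le_iff_zero_less of_nat_0_less_iff zero_less_mult_iff order_less_asym)
    moreover have "int p * x \<le> int m * int p \<longleftrightarrow> x \<le> int m" for x
      using assms(2) by (simp add: mult.commute[of "int m"])
    moreover have "\<Sum>\<^sub># (image_mset ((*) (int p)) T) = int p * \<Sum>\<^sub># T"
      by (induction T) (simp_all add: distrib_left)
    moreover have "int m * int p dvd int p * s \<longleftrightarrow> int m dvd s" for s
      using assms(2) by (simp add: mult.commute[of "int m"])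
    ultimately show ?thesis by (auto simp: zero_sum_def cong_0_iff)
  qed
  show ?thesis unfolding minimal_zero_sum_def
  proof (intro conjI allI impI)
    show "S \<noteq> {#}" "zero_sum m S" using assms(3) zs by (auto simp: minimal_zero_sum_def)
    fix T assume "T \<subset># S \<and> T \<noteq> {#}"
    then have "image_mset ((*) (int p)) T \<subset># image_mset ((*) (int p)) S" "image_mset ((*) (int p)) T \<noteq> {#}"
      by (auto intro: image_mset_subset_mono)
    then show "\<not> zero_sum m T" using assms(3) zs by (auto simp: minimal_zero_sum_def)
  qed
qed

text \<open>Every unit modulo \<open>m\<close> lifts to a unit modulo \<open>m * p\<close>, and
  residues of multiples of \<open>p\<close> are \<open>p\<close> times residues modulo
  \<open>m\<close>.\<close>

lemma balanced_scale:
  assumes m: "m > 0" "p > 0" and bal: "balanced (m * p) (p * a) (p * b) (p * c) (p * d)"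
  shows "balanced m a b c d"
  unfolding balanced_def
proof (intro allI impI)
  fix w assume "coprime w m"
  then obtain u where u: "coprime u (m * p)" "[u = w] (mod m)"
    using coprime_lift[of w m "m * p"] m by auto
  have e: "(p * x * u) mod (m * p) = p * ((x * w) mod m)" for x
  proof -
    have "[x * u = x * w] (mod m)" using u(2) by (rule cong_scalar_left)
    then show ?thesis by (simp add: cong_def mult.assoc mult.commute[of m p])
  qed
  have "(p * a * u) mod (m * p) + (p * b * u) mod (m * p) + (p * c * u) mod (m * p)
      + (p * d * u) mod (m * p) = 2 * (m * p)"
    using bal u(1) unfolding balanced_def by blast
  then have "p * ((a * w) mod m + (b * w) mod m + (c * w) mod m + (d * w) mod m) = p * (2 * m)"
    unfolding e by (simp add: distrib_left)
  then show "(a * w) mod m + (b * w) mod m + (c * w) mod m + (d * w) mod m = 2 * m" using m by simp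
qed

text \<open>If \<open>p\<close> divides none or exactly one of \<open>a\<close>, \<open>b\<close>,
  \<open>c\<close>, one of the two impossibility results applies; if it divides two of them, it
  divides the third because it divides the total.\<close>

lemma prime_dvd_all_if_dvd_one:
  fixes n p a b c d :: int
  assumes p: "prime p" "p dvd n" and n: "n > 0" "coprime n 6" and bal: "balanced n a b c d"
    and nd: "\<not> n dvd d" "\<not> n dvd a + b" "\<not> n dvd a + c" "\<not> n dvd b + c" and pd: "p dvd d"
  shows "p dvd a \<and> p dvd b \<and> p dvd c"
proof -
  obtain m where m: "n = m * p" using p(2) by (metis dvdE mult.commute)
  have sum: "p dvd a + b + c"
    using balanced_dvd_sum[OF bal] p(2) pd by (meson dvd_add_left_iff dvd_trans)
  have perm: "balanced n a c b d" "balanced n b c a d"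
    using bal by (simp_all add: balanced_def add_ac)
  have "p dvd a \<or> p dvd b \<or> p dvd c"
    using not_balanced_if_prime_dvd_one[OF p(1) n(1) m n(2) bal] nd(1) pd by blast
  moreover have "p dvd a \<or> p dvd b" if "p dvd c"
    using not_balanced_if_prime_dvd_two[OF p(1) n(1) m n(2) bal] nd(2) pd that by blast
  moreover have "p dvd a \<or> p dvd c" if "p dvd b"
    using not_balanced_if_prime_dvd_two[OF p(1) n(1) m n(2) perm(1)] nd(3) pd that by blast
  moreover have "p dvd b \<or> p dvd c" if "p dvd a"
    using not_balanced_if_prime_dvd_two[OF p(1) n(1) m n(2) perm(2)] nd(4) pd that by blast
  ultimately show ?thesis using sum by (metis dvd_add_left_iff dvd_add_right_iff dvd_add)
qed

section \<open>Correlations of centred residues and the sum \<open>t\<close>\<close>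

text \<open>The sawtooth function at \<open>a / n\<close>, except that multiples of \<open>n\<close>
  receive -1/2 instead of 0.\<close>

definition centred_residue :: "nat \<Rightarrow> int \<Rightarrow> real" where
  "centred_residue n a = of_int (a mod int n) / of_nat n - 1 / 2"

definition unit_residues :: "nat \<Rightarrow> int set" where
  "unit_residues n = {r \<in> {0..<int n}. coprime r (int n)}"

text \<open>A Dedekind-type sum restricted to units. Unlike \<open>t\<close> it treats its two
  arguments symmetrically and is additive over relations among centred residues.\<close>

definition correlation :: "nat \<Rightarrow> int \<Rightarrow> int \<Rightarrow> real" where
  "correlation n x y = (\<Sum>r\<in>unit_residues n. centred_residue n (x * r) * centred_residue n (y * r))"

lemma finite_unit_residues: "finite (unit_residues n)"
  by (rule finite_subset[of _ "{0..<int n}"]) (auto simp: unit_residues_def)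

lemma centred_residue_cong: "[a = b] (mod int n) \<Longrightarrow> centred_residue n a = centred_residue n b"
  by (simp add: centred_residue_def cong_def)

lemma sum_unit_residues_mult:
  assumes n: "n > 0" and x: "coprime x (int n)"
    and f: "\<And>a b. [a = b] (mod int n) \<Longrightarrow> f a = f b"
  shows "(\<Sum>r\<in>unit_residues n. f (x * r)) = (\<Sum>r\<in>unit_residues n. f r)"
proof -
  define h where "h r = (x * r) mod int n" for r
  have inj: "inj_on h (unit_residues n)"
    by (rule inj_on_subset[of _ "{0..<int n}"])
      (use inj_on_affine_mod[OF x, of 0] in \<open>simp_all add: h_def[abs_def] unit_residues_def subset_iff\<close>)
  have "h ` unit_residues n \<subseteq> unit_residues n"
  proof
    fix s assume "s \<in> h ` unit_residues n"
    then obtain r where r: "s = h r" "coprime r (int n)" by (auto simp: unit_residues_def)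
    have "coprime (x * r) (int n)" using x r(2) by simp
    then have "coprime s (int n)" unfolding r h_def
      using cong_imp_coprime[of "x * r" "(x * r) mod int n" "int n"] by (simp add: cong_def)
    then show "s \<in> unit_residues n" using n by (simp add: r h_def unit_residues_def)
  qed
  then have img: "h ` unit_residues n = unit_residues n"
    using inj by (intro endo_inj_surj finite_unit_residues)
  have "(\<Sum>r\<in>unit_residues n. f (x * r)) = (\<Sum>r\<in>unit_residues n. f (h r))"
    by (intro sum.cong refl f) (simp add: h_def cong_def)
  also have "\<dots> = (\<Sum>r\<in>h ` unit_residues n. f r)" using inj by (simp add: sum.reindex)
  finally show ?thesis by (simp add: img)
qed

text \<open>The terms of \<open>r\<close> and \<open>- r\<close> cancel. This requires
  \<open>n > 1\<close>, as the only unit residue modulo 1 is 0, where the value is -1/2.\<close>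

lemma sum_centred_residues:
  assumes n: "n > 1" and h: "coprime h (int n)"
  shows "(\<Sum>r\<in>unit_residues n. centred_residue n (h * r)) = 0"
proof -
  have "centred_residue n (- r) = - centred_residue n r" if "r \<in> unit_residues n" for r
  proof -
    have "\<not> int n dvd r"
      using that n coprime_absorb_right[of "int n" r] by (auto simp: unit_residues_def)
    then have "(- r) mod int n = int n - r mod int n"
      by (simp add: zmod_zminus1_eq_if dvd_eq_mod_eq_0)
    then show ?thesis using n by (simp add: centred_residue_def diff_divide_distrib)
  qed
  then have "(\<Sum>r\<in>unit_residues n. centred_residue n (- 1 * r)) = - (\<Sum>r\<in>unit_residues n. centred_residue n r)"
    by (simp add: sum_negf)
  moreover have "(\<Sum>r\<in>unit_residues n. centred_residue n (x * r)) = (\<Sum>r\<in>unit_residues n. centred_residue n r)"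
    if "coprime x (int n)" for x
    using n that by (intro sum_unit_residues_mult centred_residue_cong) auto
  from this[of "-1"] this[OF h] calculation show ?thesis by simp
qed

text \<open>The weight \<open>r / n\<close> is the centred residue plus 1/2, and the constant
  contributes nothing because the other factor sums to 0. Substituting \<open>x * r\<close> for
  \<open>r\<close> then removes the inverse.\<close>

lemma t_eq_correlation:
  assumes n: "n > 1" and x: "coprime x (int n)" and y: "coprime y (int n)"
  shows "t (modular_inverse (int n) x * y) n = correlation n x y"
proof -
  define v where "v = modular_inverse (int n) x"
  define B where "B = centred_residue n"
  have v: "[x * v = 1] (mod int n)" using x by (simp add: v_def cong_modular_inverse1)
  then have vc: "coprime (v * y) (int n)" using y
    by (metis cong_imp_coprime cong_sym coprime_1_left coprime_mult_left_iff)
  \<comment> \<open>The ranges \<open>{0..<n}\<close> and \<open>{1..n}\<close> contain the same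
    units because neither 0 nor \<open>n\<close> is prime to \<open>n > 1\<close>.\<close>
  have img: "unit_residues n = int ` {r \<in> {1..n}. coprime r n}"
  proof (intro equalityI subsetI)
    fix r assume r: "r \<in> unit_residues n"
    then have "r \<noteq> 0" using n by (auto simp: unit_residues_def)
    then have rn: "r = int (nat r)" "r \<ge> 1" "r < int n" "coprime r (int n)"
      using r by (auto simp: unit_residues_def)
    then have "coprime (nat r) n" by (metis coprime_int_iff)
    then have "nat r \<in> {r \<in> {1..n}. coprime r n}" using rn(2,3) by auto
    with rn(1) show "r \<in> int ` {r \<in> {1..n}. coprime r n}" by blast
  next
    fix r assume "r \<in> int ` {r \<in> {1..n}. coprime r n}"
    then obtain s where s: "r = int s" "s \<ge> 1" "s \<le> n" "coprime s n" by auto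
    then have "s \<noteq> n" using n by auto
    then show "r \<in> unit_residues n" using s by (simp add: unit_residues_def)
  qed
  have frac: "of_int h * real r / real n - of_int \<lfloor>of_int h * real r / real n\<rfloor> - 1 / 2 = B (h * int r)"
    for h r
  proof -
    have "\<lfloor>of_int h * real r / real n\<rfloor> = (h * int r) div int n"
      using floor_divide_of_int_eq[of "h * int r" "int n"] by simp
    moreover have "real_of_int ((h * int r) mod int n) = of_int h * real r - real n * of_int ((h * int r) div int n)"
      by (simp add: minus_mult_div_eq_mod[symmetric])
    ultimately show ?thesis using n by (simp add: B_def centred_residue_def diff_divide_distrib)
  qed
  have "t (v * y) n = (\<Sum>r\<in>unit_residues n. of_int r / real n * B (v * y * r))"
    unfolding t_def frac img by (subst sum.reindex) simp_all
  also have "\<dots> = (\<Sum>r\<in>unit_residues n. (B r + 1 / 2) * B (v * y * r))"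
    by (intro sum.cong refl) (simp add: B_def centred_residue_def unit_residues_def)
  also have "\<dots> = (\<Sum>r\<in>unit_residues n. B r * B (v * y * r)) + 1 / 2 * (\<Sum>r\<in>unit_residues n. B (v * y * r))"
    by (simp add: distrib_right sum.distrib sum_distrib_left)
  also have "(\<Sum>r\<in>unit_residues n. B (v * y * r)) = 0"
    unfolding B_def using n vc by (rule sum_centred_residues)
  also have "(\<Sum>r\<in>unit_residues n. B r * B (v * y * r)) = (\<Sum>r\<in>unit_residues n. B (x * r) * B (v * y * (x * r)))"
    using n x by (intro sum_unit_residues_mult[symmetric, of n x "\<lambda>r. B r * B (v * y * r)"])
      (auto simp: B_def intro!: arg_cong2[of _ _ _ _ "(*)"] centred_residue_cong cong_scalar_left)
  also have "\<dots> = correlation n x y" unfolding correlation_def B_def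
  proof (intro sum.cong refl arg_cong2[of _ _ _ _ "(*)"] centred_residue_cong)
    fix r
    have "[(x * v) * (y * r) = 1 * (y * r)] (mod int n)" using v by (rule cong_scalar_right)
    then show "[v * y * (x * r) = y * r] (mod int n)" by (simp add: mult_ac)
  qed
  finally show ?thesis by (simp add: v_def)
qed

lemma correlation_eq_if_balanced:
  assumes n: "n > 1" and bal: "balanced (int n) a b c d"
    and cop: "coprime a (int n)" "coprime b (int n)" "coprime c (int n)" "coprime d (int n)"
  shows "correlation n a b = correlation n c d"
proof -
  let ?B = "centred_residue n"
  have zero: "?B (a * r) + ?B (b * r) + ?B (c * r) + ?B (d * r) = 0" if "r \<in> unit_residues n" for r
  proof -
    have "(a * r) mod int n + (b * r) mod int n + (c * r) mod int n + (d * r) mod int n = 2 * int n"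
      using bal that by (simp add: balanced_def unit_residues_def)
    then have "real_of_int ((a * r) mod int n + (b * r) mod int n + (c * r) mod int n + (d * r) mod int n)
        / real n = real_of_int (2 * int n) / real n" by (simp only:)
    then show ?thesis using n by (simp add: centred_residue_def add_divide_distrib)
  qed
  have row: "correlation n x a + correlation n x b + correlation n x c + correlation n x d = 0" for x
    unfolding correlation_def sum.distrib[symmetric] distrib_left[symmetric]
    by (simp add: zero)
  have diag: "correlation n x x = correlation n 1 1" if "coprime x (int n)" for x
    unfolding correlation_def
    using sum_unit_residues_mult[OF _ that, of "\<lambda>r. ?B r * ?B r"] n centred_residue_cong by simp
  have sym: "correlation n x y = correlation n y x" for x y
    by (simp add: correlation_def mult.commute)
  \<comment> \<open>Adding the rows of \<open>a\<close> and \<open>b\<close> and subtracting those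
    of \<open>c\<close> and \<open>d\<close> cancels the diagonal and the mixed entries and leaves
    twice the desired difference.\<close>
  show ?thesis
    using row[of a] row[of b] row[of c] row[of d] diag[OF cop(1)] diag[OF cop(2)] diag[OF cop(3)]
      diag[OF cop(4)] sym[of b a] sym[of c a] sym[of d a] sym[of c b] sym[of d b] sym[of d c]
    by linarith
qed

section \<open>Descent to a smaller modulus, and correlations of permuted entries\<close>

theorem theorem2:
  fixes n :: nat and x :: "nat \<Rightarrow> int"
  assumes "exceptional n"
    and "\<forall>i\<in>{1..4}. x i \<in> {1..int n}"
    and "minimal_zero_sum n {#x 1, x 2, x 3, x 4#}"
    and "seq_index n {#x 1, x 2, x 3, x 4#} = 2"
  shows "((\<forall>m. exceptional m \<longrightarrow> n \<le> m) \<longrightarrow> (\<forall>i\<in>{1..4}. coprime (int n) (x i))) \<and>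
    ((\<forall>i\<in>{1..4}. coprime (int n) (x i)) \<longrightarrow>
      (\<forall>\<sigma>. \<sigma> permutes {1..4} \<longrightarrow>
        t (modular_inverse (int n) (x (\<sigma> 1)) * x (\<sigma> 2)) n =
        t (modular_inverse (int n) (x (\<sigma> 3)) * x (\<sigma> 4)) n))"
proof -
  have n0: "n > 0" and n6: "coprime (int n) 6"
    using assms(1) coprime_int_iff[of n 6] by (auto simp: exceptional_def)
  have four: "{1..4} = {1, 2, 3, 4::nat}" by auto
  \<comment> \<open>Subsequences are addressed by sets of indices, which also covers repeated
    entries.\<close>
  have S: "{#x 1, x 2, x 3, x 4#} = image_mset x (mset_set {1, 2, 3, 4})" by simp
  have nd: "\<not> int n dvd (\<Sum>i\<in>I. x i)" if "I \<subseteq> {1, 2, 3, 4}" "\<not> {1, 2, 3, 4} \<subseteq> I" "I \<noteq> {}" for I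
  proof -
    have "finite I" using that(1) finite_subset by blast
    then have "mset_set I \<subset># mset_set {1, 2, 3, 4}" "mset_set I \<noteq> {#}"
      unfolding subset_mset.less_le
      using that by (auto simp: mset_set_empty_iff mset_set_eq_iff simp del: mset_set.insert)
    then have "image_mset x (mset_set I) \<subset># {#x 1, x 2, x 3, x 4#}" "image_mset x (mset_set I) \<noteq> {#}"
      unfolding S by (simp_all only: image_mset_subset_mono image_mset_is_empty_iff not_False_eq_True)
    from minimal_zero_sum_not_dvd[OF assms(3) this] show ?thesis by (simp add: sum_unfold_sum_mset)
  qed
  have nd1: "\<not> int n dvd x 1" "\<not> int n dvd x 2" "\<not> int n dvd x 3" "\<not> int n dvd x 4"
    using nd[of "{1}"] nd[of "{2}"] nd[of "{3}"] nd[of "{4}"] by auto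
  have nd2: "\<not> int n dvd x 1 + x 2" "\<not> int n dvd x 1 + x 3" "\<not> int n dvd x 1 + x 4"
    "\<not> int n dvd x 2 + x 3" "\<not> int n dvd x 2 + x 4" "\<not> int n dvd x 3 + x 4"
    using nd[of "{1,2}"] nd[of "{1,3}"] nd[of "{1,4}"] nd[of "{2,3}"] nd[of "{2,4}"] nd[of "{3,4}"]
    by auto
  have n1: "n > 1" using n0 nd1(1) by (cases "n = 1") auto
  have bal: "balanced (int n) (x 1) (x 2) (x 3) (x 4)"
    using balanced_if_index_2[OF n0 nd1 assms(4)] .
  show ?thesis
  proof (intro conjI impI allI)
    assume least: "\<forall>m. exceptional m \<longrightarrow> n \<le> m"
    show "\<forall>i\<in>{1..4}. coprime (int n) (x i)"
    proof (rule ccontr)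
      assume "\<not> ?thesis"
      then obtain i where i: "i \<in> {1, 2, 3, 4}" "\<not> coprime (int n) (x i)" using four by blast
      then obtain e where "e dvd int n" "e dvd x i" "\<not> is_unit e"
        using coprimeI by blast
      then obtain q where q: "prime q" "q dvd int n" "q dvd x i"
        using n0 prime_divisor_exists[of e] by (metis dvd_trans dvd_0_left_iff of_nat_0_eq_iff less_irrefl)
      have perm: "balanced (int n) (x 2) (x 3) (x 4) (x 1)" "balanced (int n) (x 1) (x 3) (x 4) (x 2)"
        "balanced (int n) (x 1) (x 2) (x 4) (x 3)"
        using bal by (simp_all add: balanced_def add_ac)
      have pos: "int n > 0" using n0 by simp
      note all = prime_dvd_all_if_dvd_one[OF q(1,2) pos n6]
      from i(1) q(3) consider "q dvd x 1" | "q dvd x 2" | "q dvd x 3" | "q dvd x 4" by auto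
      then have q_all: "q dvd x 1 \<and> q dvd x 2 \<and> q dvd x 3 \<and> q dvd x 4"
      proof cases
        case 1
        then show ?thesis using all[OF perm(1) nd1(1) nd2(4,5,6)] by blast
      next
        case 2
        then show ?thesis using all[OF perm(2) nd1(2) nd2(2,3,6)] by blast
      next
        case 3
        then show ?thesis using all[OF perm(3) nd1(3) nd2(1,3,5)] by blast
      next
        case 4
        then show ?thesis using all[OF bal nd1(4) nd2(1,2,4)] by blast
      qed
      \<comment> \<open>Dividing all entries by the common prime gives a minimal zero-sum sequence
        of index 2 modulo \<open>n / p\<close>, against the minimality of \<open>n\<close>.\<close>
      define p where "p = nat q"
      have p: "int p = q" "p > 1" using prime_gt_1_int[OF q(1)] by (auto simp: p_def)
      have "p dvd n" using q(2) unfolding p(1)[symmetric] by simp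
      then obtain m where m: "n = m * p" by (metis dvdE mult.commute)
      have m0: "m > 0" using m n0 by simp
      define y where "y i = x i div q" for i
      have y: "x 1 = q * y 1" "x 2 = q * y 2" "x 3 = q * y 3" "x 4 = q * y 4"
        using q_all by (simp_all add: y_def)
      have "balanced (int m * q) (q * y 1) (q * y 2) (q * y 3) (q * y 4)"
        using bal unfolding y m by (simp add: p(1))
      then have bal': "balanced (int m) (y 1) (y 2) (y 3) (y 4)"
        using balanced_scale[of "int m" q] m0 prime_gt_0_int[OF q(1)] by simp
      have Sy: "{#x 1, x 2, x 3, x 4#} = image_mset ((*) (int p)) {#y 1, y 2, y 3, y 4#}"
        using y p(1) by simp
      have "p > 0" using p(2) by simp
      then have min': "minimal_zero_sum m {#y 1, y 2, y 3, y 4#}"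
        by (rule minimal_zero_sum_scale[OF m0 _ assms(3)[unfolded Sy m]])
      have nd_y: "\<not> int m dvd y j" if "\<not> int n dvd q * y j" for j
        using that p(1) by (metis m mult.commute mult_dvd_mono dvd_refl of_nat_mult)
      have "seq_index m {#y 1, y 2, y 3, y 4#} = 2"
        by (rule index_2_if_balanced[OF m0 nd1[unfolded y, THEN nd_y] bal'])
      moreover have "coprime m 6" using assms(1) by (simp add: exceptional_def m)
      ultimately have "exceptional m" using min' m0 unfolding exceptional_def
        by (intro conjI exI[of _ "{#y 1, y 2, y 3, y 4#}"]) auto
      then have "n \<le> m" using least by blast
      then show False using m m0 p(2) by simp
    qed
  next
    fix \<sigma> assume cop: "\<forall>i\<in>{1..4}. coprime (int n) (x i)" and \<sigma>: "\<sigma> permutes {1..4::nat}"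
    have c: "coprime (x (\<sigma> i)) (int n)" if "i \<in> {1..4}" for i
      using cop permutes_in_image[OF \<sigma>, of i] that by (simp add: coprime_commute)
    have "balanced (int n) (x (\<sigma> 1)) (x (\<sigma> 2)) (x (\<sigma> 3)) (x (\<sigma> 4))"
      unfolding balanced_def
    proof (intro allI impI)
      fix u assume u: "coprime u (int n)"
      have "(\<Sum>i\<in>{1..4}. (x (\<sigma> i) * u) mod int n) = (\<Sum>i\<in>{1..4}. (x i * u) mod int n)"
        using sum.permute[OF \<sigma>, of "\<lambda>i. (x i * u) mod int n"] by (simp add: o_def)
      then show "(x (\<sigma> 1) * u) mod int n + (x (\<sigma> 2) * u) mod int n + (x (\<sigma> 3) * u) mod int n
          + (x (\<sigma> 4) * u) mod int n = 2 * int n"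
        using bal u unfolding four by (simp add: balanced_def add.assoc)
    qed
    then have "correlation n (x (\<sigma> 1)) (x (\<sigma> 2)) = correlation n (x (\<sigma> 3)) (x (\<sigma> 4))"
      using n1 c by (intro correlation_eq_if_balanced) auto
    then show "t (modular_inverse (int n) (x (\<sigma> 1)) * x (\<sigma> 2)) n =
        t (modular_inverse (int n) (x (\<sigma> 3)) * x (\<sigma> 4)) n"
      using n1 c by (simp add: t_eq_correlation)
  qed
qed

end
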